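(* Consider an ILP instance: minimize $c^\top x$ subject to $Ax\le b$, $x\in\mathbb{Z}^n$, such that $c\neq0$, no variable is free, and a finite optimal solution and finite optimal objective value exist. Let $P=\{x\in\mathbb{R}^n\mid Ax\le b\}$. Any feasible solution obtained in the local search algorithm Local-ILP is a boundary solution. That is, if $\alpha'\in\mathbb{Z}^n$ is generated from a current solution $\alpha\in\mathbb{Z}^n$ satisfying the global bounds $x^l\le\alpha\le x^u$ by one of the following four ways in which the algorithm generates solutions, and $\alpha'\in P$, then $\alpha'\in\delta(P)$: (1) $\alpha$ is infeasible and $\alpha'$ is obtained by applying a tight move to $\alpha$; (2) $\alpha$ is feasible and $\alpha'$ is obtained by applying a lift move to $\alpha$; (3) $\alpha$ is feasible, there is no positive lift move operation at $\alpha$, and $\alpha'$ is obtained by applying a unit incremental move to $\alpha$; (4) $\alpha'$ is obtained from $\alpha$ by moving the value of one variable to one side of its global bound (i.e. setting it to its finite lower bound or its finite upper bound).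
   Context: Here $A\in\mathbb{R}^{m\times n}$, $b\in\mathbb{R}^m$, $c\in\mathbb{R}^n$, $J=\{1,\dots,n\}$, $A_i$ is the $i$-th row of $A$, and $obj(x)=c^\top x$. Each variable $x_j$ has a global lower bound $x^l_j\in\mathbb{Z}\cup\{-\infty\}$ and upper bound $x^u_j\in\mathbb{Z}\cup\{+\infty\}$; all (finite) variable bounds are included among the rows of $Ax\le b$. A variable is free if it does not appear in any constraint, has both bounds infinite, and does not appear in $c^\top x$. A solution is a vector $\alpha\in\mathbb{Z}^n$; it is feasible if $\alpha\in P$. Boundary points: let $e_j$ be the $j$-th unit vector and $U=\bigcup_{j\in J}\{e_j,-e_j\}$. A point $x\in\mathbb{Z}^n$ is a boundary point of $P$ if $x\in P$ and there is $d\in U$ with $x+d\notin P$; $\delta(P)$ is the set of boundary points. A boundary solution of the ILP is an element of $\delta(P)$. Tight move: for $i,j$ with $A_{ij}\ne0$ let $\Delta=b_i-A_i\cdot\alpha$. The tight move $tm(x_j,con_i,\alpha)$ changes only $\alpha_j$: (i) if $\Delta<0$: when $A_{ij}<0$, $\alpha_j$ is increased by $\min(\lceil\Delta/A_{ij}\rceil,\ x^u_j-\alpha_j)$; when $A_{ij}>0$, $\alpha_j$ is decreased by $\min(|\lfloor\Delta/A_{ij}\rfloor|,\ |x^l_j-\alpha_j|)$; (ii) if $\Delta\ge0$: when $A_{ij}<0$, $\alpha_j$ is decreased by $\min(|\lceil\Delta/A_{ij}\rceil|,\ |x^l_j-\alpha_j|)$; when $A_{ij}>0$, $\alpha_j$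 is increased by $\min(\lfloor\Delta/A_{ij}\rfloor,\ x^u_j-\alpha_j)$. Lift move: let $\alpha$ be feasible. For a constraint $i$ with $A_{ij}\neq0$ and $\Delta=b_i-A_i\cdot\alpha$, let $ldc(x_j,con_i,\alpha)=[\alpha_j+\lceil\Delta/A_{ij}\rceil,+\infty)$ if $A_{ij}<0$ and $(-\infty,\alpha_j+\lfloor\Delta/A_{ij}\rfloor]$ if $A_{ij}>0$. Let $lfd(x_j,\alpha)=\left(\bigcap_i ldc(x_j,con_i,\alpha)\right)\cap[x^l_j,x^u_j]$, the intersection being over constraints $i$ with $A_{ij}\neq 0$. For $c_j\ne0$, the lift move $lm(x_j,\alpha)$ changes only $\alpha_j$, setting it to the upper bound of $lfd(x_j,\alpha)$ if $c_j<0$ and to the lower bound if $c_j>0$. A lift move from $\alpha$ to $\alpha'$ is positive if $obj(\alpha)-obj(\alpha')>0$. Unit incremental move: choose a variable $x_j$ appearing in the objective function ($c_j\ne0$) and replace $\alpha_j$ by $\alpha_j+1$ if $c_j<0$ and by $\alpha_j-1$ if $c_j>0$, where $j$ is chosen so that the new value stays within the global bounds of $x_j$. *)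

theory Defs
  imports "HOL-Analysis.Analysis"
begin

text \<open>Integer vectors are real vectors with integral coordinates. Global bounds take values in
  the extended reals.\<close>

definition int_points :: "(real ^ 'n) set" where
  "int_points = {x. \<forall>j. x $ j \<in> \<int>}"

definition feasible_region :: "real ^ 'n ^ 'm \<Rightarrow> real ^ 'm \<Rightarrow> (real ^ 'n) set" where
  "feasible_region A b = {x. A *v x \<le> b}"

definition unit_moves :: "(real ^ 'n) set" where
  "unit_moves = (\<Union>j. {axis j 1, - axis j 1})"

definition boundary_points :: "(real ^ 'n) set \<Rightarrow> (real ^ 'n) set" where
  "boundary_points P = {x \<in> int_points. x \<in> P \<and> (\<exists>d\<in>unit_moves. x + d \<notin> P)}"

definition valid_bounds :: "('n \<Rightarrow> ereal) \<Rightarrow> ('n \<Rightarrow> ereal) \<Rightarrow> bool" where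
  "valid_bounds xl xu \<longleftrightarrow>
     (\<forall>j. xl j \<in> insert (- \<infinity>) (ereal ` \<int>) \<and> xu j \<in> insert \<infinity> (ereal ` \<int>))"

definition bounds_are_rows ::
    "real ^ 'n ^ 'm \<Rightarrow> real ^ 'm \<Rightarrow> ('n \<Rightarrow> ereal) \<Rightarrow> ('n \<Rightarrow> ereal) \<Rightarrow> bool" where
  "bounds_are_rows A b xl xu \<longleftrightarrow>
     (\<forall>j l. xl j = ereal l \<longrightarrow> (\<exists>i. row i A = - axis j 1 \<and> b $ i = - l)) \<and>
     (\<forall>j u. xu j = ereal u \<longrightarrow> (\<exists>i. row i A = axis j 1 \<and> b $ i = u))"

definition free_variable ::
    "real ^ 'n ^ 'm \<Rightarrow> real ^ 'n \<Rightarrow> ('n \<Rightarrow> ereal) \<Rightarrow> ('n \<Rightarrow> ereal) \<Rightarrow> 'n \<Rightarrow> bool" where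
  "free_variable A c xl xu j \<longleftrightarrow>
     (\<forall>i. A $ i $ j = 0) \<and> xl j = - \<infinity> \<and> xu j = \<infinity> \<and> c $ j = 0"

definition optimal_solution ::
    "real ^ 'n ^ 'm \<Rightarrow> real ^ 'm \<Rightarrow> real ^ 'n \<Rightarrow> real ^ 'n \<Rightarrow> bool" where
  "optimal_solution A b c x \<longleftrightarrow>
     x \<in> int_points \<inter> feasible_region A b \<and>
     (\<forall>y \<in> int_points \<inter> feasible_region A b. c \<bullet> x \<le> c \<bullet> y)"

definition within_bounds :: "('n \<Rightarrow> ereal) \<Rightarrow> ('n \<Rightarrow> ereal) \<Rightarrow> real ^ 'n \<Rightarrow> bool" where
  "within_bounds xl xu \<alpha> \<longleftrightarrow> (\<forall>j. xl j \<le> ereal (\<alpha> $ j) \<and> ereal (\<alpha> $ j) \<le> xu j)"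

definition set_coord :: "real ^ 'n \<Rightarrow> 'n \<Rightarrow> real \<Rightarrow> real ^ 'n" where
  "set_coord \<alpha> j v = (\<chi> k. if k = j then v else \<alpha> $ k)"

definition slack :: "real ^ 'n ^ 'm \<Rightarrow> real ^ 'm \<Rightarrow> 'm \<Rightarrow> real ^ 'n \<Rightarrow> real" where
  "slack A b i \<alpha> = b $ i - row i A \<bullet> \<alpha>"

text \<open>Each minimum below is taken in the extended reals because a global bound may be infinite.
  Its first argument is finite, and for a valid assignment within the bounds the second one is
  nonnegative, so the minimum is a finite number and \<^const>\<open>real_of_ereal\<close> loses nothing.\<close>

definition tight_move ::
    "real ^ 'n ^ 'm \<Rightarrow> real ^ 'm \<Rightarrow> ('n \<Rightarrow> ereal) \<Rightarrow> ('n \<Rightarrow> ereal) \<Rightarrow> 'n \<Rightarrow> 'm \<Rightarrow>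
     real ^ 'n \<Rightarrow> real ^ 'n" where
  "tight_move A b xl xu j i \<alpha> =
     (let \<Delta> = slack A b i \<alpha>; a = A $ i $ j;
          up = (\<lambda>s::int. \<alpha> $ j + real_of_ereal (min (ereal s) (xu j - ereal (\<alpha> $ j))));
          down = (\<lambda>s::int. \<alpha> $ j - real_of_ereal (min (ereal s) \<bar>xl j - ereal (\<alpha> $ j)\<bar>))
      in set_coord \<alpha> j
        (if \<Delta> < 0
         then (if a < 0 then up \<lceil>\<Delta> / a\<rceil> else down \<bar>\<lfloor>\<Delta> / a\<rfloor>\<bar>)
         else (if a < 0 then down \<bar>\<lceil>\<Delta> / a\<rceil>\<bar> else up \<lfloor>\<Delta> / a\<rfloor>)))"

text \<open>Only meaningful, and only used, for indices with a nonzero coefficient.\<close>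

definition ldc :: "real ^ 'n ^ 'm \<Rightarrow> real ^ 'm \<Rightarrow> 'n \<Rightarrow> 'm \<Rightarrow> real ^ 'n \<Rightarrow> real set" where
  "ldc A b j i \<alpha> =
     (if A $ i $ j < 0 then {\<alpha> $ j + of_int \<lceil>slack A b i \<alpha> / A $ i $ j\<rceil> ..}
      else {.. \<alpha> $ j + of_int \<lfloor>slack A b i \<alpha> / A $ i $ j\<rfloor>})"

definition lfd ::
    "real ^ 'n ^ 'm \<Rightarrow> real ^ 'm \<Rightarrow> ('n \<Rightarrow> ereal) \<Rightarrow> ('n \<Rightarrow> ereal) \<Rightarrow> 'n \<Rightarrow> real ^ 'n \<Rightarrow>
     real set" where
  "lfd A b xl xu j \<alpha> =
     (\<Inter>i\<in>{i. A $ i $ j \<noteq> 0}. ldc A b j i \<alpha>) \<inter> {v. xl j \<le> ereal v \<and> ereal v \<le> xu j}"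

text \<open>A relation rather than a function: the move exists only if the closed interval
  \<^const>\<open>lfd\<close> has a finite endpoint on the relevant side.\<close>

definition lift_move ::
    "real ^ 'n ^ 'm \<Rightarrow> real ^ 'm \<Rightarrow> real ^ 'n \<Rightarrow> ('n \<Rightarrow> ereal) \<Rightarrow> ('n \<Rightarrow> ereal) \<Rightarrow> 'n \<Rightarrow>
     real ^ 'n \<Rightarrow> real ^ 'n \<Rightarrow> bool" where
  "lift_move A b c xl xu j \<alpha> \<alpha>' \<longleftrightarrow>
     c $ j \<noteq> 0 \<and>
     (\<exists>v \<in> lfd A b xl xu j \<alpha>.
        (if c $ j < 0 then \<forall>w \<in> lfd A b xl xu j \<alpha>. w \<le> v
         else \<forall>w \<in> lfd A b xl xu j \<alpha>. v \<le> w) \<and>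
        \<alpha>' = set_coord \<alpha> j v)"

definition positive_lift_move ::
    "real ^ 'n ^ 'm \<Rightarrow> real ^ 'm \<Rightarrow> real ^ 'n \<Rightarrow> ('n \<Rightarrow> ereal) \<Rightarrow> ('n \<Rightarrow> ereal) \<Rightarrow> 'n \<Rightarrow>
     real ^ 'n \<Rightarrow> real ^ 'n \<Rightarrow> bool" where
  "positive_lift_move A b c xl xu j \<alpha> \<alpha>' \<longleftrightarrow>
     lift_move A b c xl xu j \<alpha> \<alpha>' \<and> c \<bullet> \<alpha> - c \<bullet> \<alpha>' > 0"

definition unit_incremental_move ::
    "real ^ 'n \<Rightarrow> ('n \<Rightarrow> ereal) \<Rightarrow> ('n \<Rightarrow> ereal) \<Rightarrow> 'n \<Rightarrow> real ^ 'n \<Rightarrow> real ^ 'n \<Rightarrow> bool" where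
  "unit_incremental_move c xl xu j \<alpha> \<alpha>' \<longleftrightarrow>
     c $ j \<noteq> 0 \<and>
     \<alpha>' = set_coord \<alpha> j (if c $ j < 0 then \<alpha> $ j + 1 else \<alpha> $ j - 1) \<and>
     xl j \<le> ereal (\<alpha>' $ j) \<and> ereal (\<alpha>' $ j) \<le> xu j"

definition bound_move ::
    "('n \<Rightarrow> ereal) \<Rightarrow> ('n \<Rightarrow> ereal) \<Rightarrow> 'n \<Rightarrow> real ^ 'n \<Rightarrow> real ^ 'n \<Rightarrow> bool" where
  "bound_move xl xu j \<alpha> \<alpha>' \<longleftrightarrow>
     (\<exists>v. (ereal v = xl j \<or> ereal v = xu j) \<and> \<alpha>' = set_coord \<alpha> j v)"

end

theory Submission
  imports Defs
begin

text \<open>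
  Every move changes a single coordinate \<open>j\<close>, so only the line through \<open>\<alpha>\<close> in direction \<open>e\<^sub>j\<close>
  matters. It suffices to find a sign \<open>s\<close> such that the step \<open>s e\<^sub>j\<close> from \<open>\<alpha>'\<close> leaves the region
  (\<open>boundary_if_unit_step_infeasible\<close>).

  A move onto a finite global bound ends at a boundary point, because the bound is itself a row of the
  system and the step beyond it violates that row (\<open>boundary_if_at_bound\<close>). A tight move
  that is not cut off by a global bound goes to the last integer allowed by its constraint; the next
  integer in the direction \<open>sgn A\<^sub>i\<^sub>j\<close> violates that constraint.

  For the lift move and the unit incremental move, let \<open>s = - sgn c\<^sub>j\<close> be the improving direction. On
  integer points of the line, membership in \<^const>\<open>lfd\<close> is the same as feasibility
  (\<open>lfd_if_feasible\<close> and \<open>feasible_if_lfd\<close>). A lift move goes to the endpoint of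
  \<^const>\<open>lfd\<close> in direction \<open>s\<close>, so one more step leaves the region.
  A unit incremental move from a feasible point without positive lift move never reaches a feasible
  point: the finite optimum bounds the feasible part of the line in the improving direction, hence a
  lift move in \<open>x\<^sub>j\<close> exists, and it would be positive if an improving unit step were feasible
  (\<open>positive_lift_move_if_unit_step_feasible\<close>).
\<close>

section \<open>Moving along a coordinate line\<close>

lemma set_coord_nth: "set_coord \<alpha> j v $ k = (if k = j then v else \<alpha> $ k)"
  by (simp add: set_coord_def)

lemma set_coord_set_coord [simp]: "set_coord (set_coord \<alpha> j v) j w = set_coord \<alpha> j w"
  by (simp add: vec_eq_iff set_coord_nth)

lemma set_coord_eq_add_axis: "set_coord \<alpha> j v = \<alpha> + (v - \<alpha> $ j) *\<^sub>R axis j 1"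
  by (simp add: vec_eq_iff set_coord_nth axis_def)

lemma inner_set_coord: "x \<bullet> set_coord \<alpha> j v = x \<bullet> \<alpha> + x $ j * (v - \<alpha> $ j)"
  by (simp add: set_coord_eq_add_axis inner_add_right inner_axis)

lemma feasible_region_iff_slack: "x \<in> feasible_region A b \<longleftrightarrow> (\<forall>i. 0 \<le> slack A b i x)"
  by (simp add: feasible_region_def slack_def less_eq_vec_def matrix_vector_mul_component row_def)

lemma slack_set_coord:
  "slack A b i (set_coord \<alpha> j v) = slack A b i \<alpha> - A $ i $ j * (v - \<alpha> $ j)"
  by (simp add: slack_def inner_set_coord row_def)

lemma boundary_if_unit_step_infeasible:
  assumes "x \<in> int_points" "x \<in> feasible_region A b"
    and s: "s = 1 \<or> s = -1"
    and "set_coord x j (x $ j + s) \<notin> feasible_region A b"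
  shows "x \<in> boundary_points (feasible_region A b)"
proof -
  have "s *\<^sub>R axis j 1 \<in> unit_moves"
    using s by (auto simp: unit_moves_def)
  then show ?thesis
    using assms by (auto simp: boundary_points_def set_coord_eq_add_axis)
qed

section \<open>Global bounds\<close>

lemma within_bounds_if_feasible:
  assumes valid: "valid_bounds xl xu" and rows: "bounds_are_rows A b xl xu"
    and x: "x \<in> feasible_region A b"
  shows "xl j \<le> ereal (x $ j)" "ereal (x $ j) \<le> xu j"
proof -
  have sl: "0 \<le> slack A b i x" for i
    using x by (simp add: feasible_region_iff_slack)
  show "xl j \<le> ereal (x $ j)"
  proof (cases "xl j = - \<infinity>")
    case False
    then obtain l where l: "xl j = ereal l"
      using valid by (auto simp: valid_bounds_def)
    then obtain i where "row i A = - axis j 1" "b $ i = - l"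
      using rows unfolding bounds_are_rows_def by blast
    with sl[of i] show ?thesis
      by (simp add: l slack_def inner_axis')
  qed simp
  show "ereal (x $ j) \<le> xu j"
  proof (cases "xu j = \<infinity>")
    case False
    then obtain u where u: "xu j = ereal u"
      using valid by (auto simp: valid_bounds_def)
    then obtain i where "row i A = axis j 1" "b $ i = u"
      using rows unfolding bounds_are_rows_def by blast
    with sl[of i] show ?thesis
      by (simp add: u slack_def inner_axis')
  qed simp
qed

lemma boundary_if_at_bound:
  assumes "valid_bounds xl xu" "bounds_are_rows A b xl xu"
    and "x \<in> int_points" "x \<in> feasible_region A b"
    and "ereal (x $ j) = xl j \<or> ereal (x $ j) = xu j"
  shows "x \<in> boundary_points (feasible_region A b)"
proof -
  have out: "set_coord x j (x $ j + s) \<notin> feasible_region A b"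
    if "\<not> (xl j \<le> ereal (x $ j + s) \<and> ereal (x $ j + s) \<le> xu j)" for s
    using within_bounds_if_feasible[OF assms(1,2), of "set_coord x j (x $ j + s)" j] that
    by (auto simp: set_coord_nth)
  show ?thesis
    using assms(5)
  proof
    assume "ereal (x $ j) = xl j"
    then show ?thesis
      using boundary_if_unit_step_infeasible[OF assms(3,4), of "-1"] out[of "-1"]
      by (auto simp flip: \<open>ereal (x $ j) = xl j\<close>)
  next
    assume "ereal (x $ j) = xu j"
    then show ?thesis
      using boundary_if_unit_step_infeasible[OF assms(3,4), of 1] out[of 1]
      by (auto simp flip: \<open>ereal (x $ j) = xu j\<close>)
  qed
qed

section \<open>Tight moves\<close>

text \<open>For integer arguments the rounding in \<^const>\<open>ldc\<close> loses nothing: it is the single-row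
  feasibility condition along the line.\<close>

lemma ldc_iff_slack:
  assumes "\<alpha> $ j \<in> \<int>" "w \<in> \<int>" "A $ i $ j \<noteq> 0"
  shows "w \<in> ldc A b j i \<alpha> \<longleftrightarrow> 0 \<le> slack A b i (set_coord \<alpha> j w)"
proof -
  obtain p q where pq: "\<alpha> $ j = of_int p" "w = of_int q"
    using assms by (auto elim!: Ints_cases)
  define a \<Delta> where "a = A $ i $ j" and "\<Delta> = slack A b i \<alpha>"
  consider "a < 0" | "a > 0"
    using assms by (force simp: a_def)
  then show ?thesis
  proof cases
    case 1
    have "w \<in> ldc A b j i \<alpha> \<longleftrightarrow> \<lceil>\<Delta> / a\<rceil> \<le> q - p"
      using 1 unfolding ldc_def a_def \<Delta>_def pq by simp linarith
    also have "\<dots> \<longleftrightarrow> a * (w - \<alpha> $ j) \<le> \<Delta>"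
      using 1 by (simp add: ceiling_le_iff pq neg_divide_le_eq mult.commute)
    finally show ?thesis
      by (simp add: slack_set_coord a_def \<Delta>_def)
  next
    case 2
    have "w \<in> ldc A b j i \<alpha> \<longleftrightarrow> q - p \<le> \<lfloor>\<Delta> / a\<rfloor>"
      using 2 unfolding ldc_def a_def \<Delta>_def pq by simp linarith
    also have "\<dots> \<longleftrightarrow> a * (w - \<alpha> $ j) \<le> \<Delta>"
      using 2 by (simp add: le_floor_iff pq pos_le_divide_eq mult.commute)
    finally show ?thesis
      by (simp add: slack_set_coord a_def \<Delta>_def)
  qed
qed

lemma bounded_increase_cases:
  fixes x s :: real
  assumes "ereal x \<le> u"
  defines "y \<equiv> x + real_of_ereal (min (ereal s) (u - ereal x))"
  shows "y = x + s \<or> ereal y = u"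
  using assms(1) unfolding y_def by (cases u) (auto simp: min_def)

lemma bounded_decrease_cases:
  fixes x s :: real
  assumes "l \<le> ereal x"
  defines "y \<equiv> x - real_of_ereal (min (ereal s) \<bar>l - ereal x\<bar>)"
  shows "y = x - s \<or> ereal y = l"
  using assms(1) unfolding y_def by (cases l) (auto simp: min_def)

text \<open>The sign of the slack only decides in which direction the tight move goes. In both cases its
  target is the same finite endpoint of \<^const>\<open>ldc\<close>, unless a global bound stops the move first.\<close>

lemma tight_move_cases:
  fixes b :: "real ^ 'm"
  assumes "within_bounds xl xu \<alpha>" and a: "A $ i $ j \<noteq> 0"
  defines "v \<equiv> tight_move A b xl xu j i \<alpha> $ j"
  shows "ereal v = xl j \<or> ereal v = xu j \<or>
    v = \<alpha> $ j + of_int (if A $ i $ j < 0 then \<lceil>slack A b i \<alpha> / A $ i $ j\<rceil>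
                         else \<lfloor>slack A b i \<alpha> / A $ i $ j\<rfloor>)"
proof -
  define q where "q = slack A b i \<alpha> / A $ i $ j"
  have bounds: "xl j \<le> ereal (\<alpha> $ j)" "ereal (\<alpha> $ j) \<le> xu j"
    using assms(1) by (auto simp: within_bounds_def)
  note up = bounded_increase_cases[OF bounds(2)] and down = bounded_decrease_cases[OF bounds(1)]
  consider "slack A b i \<alpha> < 0" "A $ i $ j < 0" | "slack A b i \<alpha> < 0" "A $ i $ j > 0"
    | "slack A b i \<alpha> \<ge> 0" "A $ i $ j < 0" | "slack A b i \<alpha> \<ge> 0" "A $ i $ j > 0"
    using a by linarith
  then show ?thesis
  proof cases
    case 1
    then show ?thesis
      using up[of "of_int \<lceil>q\<rceil>"] by (auto simp: v_def tight_move_def Let_def set_coord_nth q_def)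
  next
    case 2
    have "q \<le> 0" using 2 by (simp add: q_def divide_le_0_iff)
    then have "\<bar>\<lfloor>q\<rfloor>\<bar> = - \<lfloor>q\<rfloor>" by linarith
    then show ?thesis
      using 2 down[of "of_int \<bar>\<lfloor>q\<rfloor>\<bar>"]
      by (auto simp: v_def tight_move_def Let_def set_coord_nth q_def)
  next
    case 3
    have "q \<le> 0" using 3 by (simp add: q_def divide_le_0_iff)
    then have "\<bar>\<lceil>q\<rceil>\<bar> = - \<lceil>q\<rceil>" by (simp add: ceiling_le_iff)
    then show ?thesis
      using 3 down[of "of_int \<bar>\<lceil>q\<rceil>\<bar>"]
      by (auto simp: v_def tight_move_def Let_def set_coord_nth q_def)
  next
    case 4
    then show ?thesis
      using up[of "of_int \<lfloor>q\<rfloor>"] by (auto simp: v_def tight_move_def Let_def set_coord_nth q_def)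
  qed
qed

lemma tight_move_eq_set_coord:
  "tight_move A b xl xu j i \<alpha> = set_coord \<alpha> j (tight_move A b xl xu j i \<alpha> $ j)"
  by (simp add: tight_move_def Let_def set_coord_nth)

lemma tight_move_boundary:
  assumes bounds: "valid_bounds xl xu" "bounds_are_rows A b xl xu" "within_bounds xl xu \<alpha>"
    and \<alpha>: "\<alpha> \<in> int_points" and a: "A $ i $ j \<noteq> 0"
    and \<alpha>': "\<alpha>' = tight_move A b xl xu j i \<alpha>" "\<alpha>' \<in> int_points" "\<alpha>' \<in> feasible_region A b"
  shows "\<alpha>' \<in> boundary_points (feasible_region A b)"
proof (cases "ereal (\<alpha>' $ j) = xl j \<or> ereal (\<alpha>' $ j) = xu j")
  case True
  then show ?thesis
    using boundary_if_at_bound bounds \<alpha>' by blast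
next
  case False
  \<comment> \<open>\<^const>\<open>ldc\<close> is unbounded against the sign of the coefficient and ends in its direction.\<close>
  define s where "s = sgn (A $ i $ j)"
  define w where "w = \<alpha>' $ j + s"
  have s: "s = 1 \<or> s = -1"
    using a by (auto simp: s_def sgn_if)
  have int: "\<alpha> $ j \<in> \<int>" "\<alpha>' $ j \<in> \<int>"
    using \<alpha> \<alpha>'(2) by (auto simp: int_points_def)
  have "w \<notin> ldc A b j i \<alpha>"
    using tight_move_cases[where b = b, OF bounds(3) a] False a
    by (auto simp: \<alpha>'(1) w_def s_def ldc_def sgn_if)
  moreover have "w \<in> \<int>"
    using s int by (auto simp: w_def)
  ultimately have "set_coord \<alpha> j w \<notin> feasible_region A b"
    using ldc_iff_slack[of \<alpha> j w A i b] int a by (auto simp: feasible_region_iff_slack)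
  also have "set_coord \<alpha> j w = set_coord \<alpha>' j w"
    using arg_cong[OF tight_move_eq_set_coord, of "\<lambda>x. set_coord x j w" A b xl xu j i \<alpha>]
    by (simp add: \<alpha>'(1))
  finally show ?thesis
    using boundary_if_unit_step_infeasible[OF \<alpha>'(2,3) s] by (simp add: w_def)
qed

section \<open>Lift moves\<close>

lemma lfd_if_feasible:
  assumes "valid_bounds xl xu" "bounds_are_rows A b xl xu"
    and "\<alpha> $ j \<in> \<int>" "w \<in> \<int>" "set_coord \<alpha> j w \<in> feasible_region A b"
  shows "w \<in> lfd A b xl xu j \<alpha>"
  using within_bounds_if_feasible[OF assms(1,2,5), of j] assms ldc_iff_slack[of \<alpha> j w A _ b]
  by (auto simp: lfd_def set_coord_nth feasible_region_iff_slack)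

text \<open>Feasibility of \<open>\<alpha>\<close> takes care of the rows in which \<open>x\<^sub>j\<close> does not occur.\<close>

lemma feasible_if_lfd:
  assumes "\<alpha> \<in> feasible_region A b" "\<alpha> $ j \<in> \<int>" "w \<in> \<int>" "w \<in> lfd A b xl xu j \<alpha>"
  shows "set_coord \<alpha> j w \<in> feasible_region A b"
  unfolding feasible_region_iff_slack
proof
  fix i
  show "0 \<le> slack A b i (set_coord \<alpha> j w)"
  proof (cases "A $ i $ j = 0")
    case True
    then show ?thesis
      using assms(1) by (simp add: slack_set_coord feasible_region_iff_slack)
  next
    case False
    then show ?thesis
      using assms ldc_iff_slack[of \<alpha> j w A i b] by (auto simp: lfd_def)
  qed
qed

text \<open>All endpoints of \<^const>\<open>lfd\<close> are integers, so a bound for its integer elements is a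
  bound for all its elements.\<close>

lemma lfd_round:
  assumes "valid_bounds xl xu" "\<alpha> $ j \<in> \<int>" "w \<in> lfd A b xl xu j \<alpha>"
  shows "of_int \<lfloor>w\<rfloor> \<in> lfd A b xl xu j \<alpha>" "of_int \<lceil>w\<rceil> \<in> lfd A b xl xu j \<alpha>"
proof -
  obtain p where p: "\<alpha> $ j = of_int p"
    using assms(2) by (auto elim: Ints_cases)
  have "of_int \<lfloor>w\<rfloor> \<in> ldc A b j i \<alpha> \<and> of_int \<lceil>w\<rceil> \<in> ldc A b j i \<alpha>" if "w \<in> ldc A b j i \<alpha>" for i
  proof (cases "A $ i $ j < 0")
    case True
    then have "p + \<lceil>slack A b i \<alpha> / A $ i $ j\<rceil> \<le> \<lfloor>w\<rfloor>"
      using that by (simp add: ldc_def p le_floor_iff)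
    moreover from this have "p + \<lceil>slack A b i \<alpha> / A $ i $ j\<rceil> \<le> \<lceil>w\<rceil>"
      using floor_le_ceiling[of w] by linarith
    ultimately show ?thesis
      using True by (simp add: ldc_def p flip: of_int_add)
  next
    case False
    then have "\<lceil>w\<rceil> \<le> p + \<lfloor>slack A b i \<alpha> / A $ i $ j\<rfloor>"
      using that by (simp add: ldc_def p ceiling_le_iff)
    moreover from this have "\<lfloor>w\<rfloor> \<le> p + \<lfloor>slack A b i \<alpha> / A $ i $ j\<rfloor>"
      using floor_le_ceiling[of w] by linarith
    ultimately show ?thesis
      using False by (simp add: ldc_def p flip: of_int_add)
  qed
  moreover have "xl j \<le> ereal (of_int \<lfloor>w\<rfloor>) \<and> xl j \<le> ereal (of_int \<lceil>w\<rceil>)"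
    if "xl j \<le> ereal w"
  proof (cases "xl j = - \<infinity>")
    case False
    then have "xl j \<in> ereal ` \<int>"
      using assms(1) by (auto simp: valid_bounds_def)
    then obtain l where "xl j = ereal (of_int l)"
      unfolding Ints_def by blast
    then show ?thesis using that by simp linarith
  qed simp
  moreover have "ereal (of_int \<lfloor>w\<rfloor>) \<le> xu j \<and> ereal (of_int \<lceil>w\<rceil>) \<le> xu j"
    if "ereal w \<le> xu j"
  proof (cases "xu j = \<infinity>")
    case False
    then have "xu j \<in> ereal ` \<int>"
      using assms(1) by (auto simp: valid_bounds_def)
    then obtain u where "xu j = ereal (of_int u)"
      unfolding Ints_def by blast
    then show ?thesis using that by simp linarith
  qed simp
  ultimately show "of_int \<lfloor>w\<rfloor> \<in> lfd A b xl xu j \<alpha>" "of_int \<lceil>w\<rceil> \<in> lfd A b xl xu j \<alpha>"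
    using assms(3) by (auto simp: lfd_def)
qed

text \<open>Measuring along the improving direction \<open>- sgn c\<^sub>j\<close> turns both cases of the lift move into a
  maximisation.\<close>

lemma lift_move_iff_extreme:
  "lift_move A b c xl xu j \<alpha> \<beta> \<longleftrightarrow> c $ j \<noteq> 0 \<and>
     (\<exists>v \<in> lfd A b xl xu j \<alpha>.
        (\<forall>w \<in> lfd A b xl xu j \<alpha>. - sgn (c $ j) * w \<le> - sgn (c $ j) * v) \<and>
        \<beta> = set_coord \<alpha> j v)"
  by (cases "c $ j" "0 :: real" rule: linorder_cases) (simp_all add: lift_move_def)

lemma lift_move_boundary:
  assumes bounds: "valid_bounds xl xu" "bounds_are_rows A b xl xu"
    and \<alpha>: "\<alpha> \<in> int_points" and lift: "lift_move A b c xl xu j \<alpha> \<alpha>'"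
    and \<alpha>': "\<alpha>' \<in> int_points" "\<alpha>' \<in> feasible_region A b"
  shows "\<alpha>' \<in> boundary_points (feasible_region A b)"
proof -
  define s where "s = - sgn (c $ j)"
  obtain v where v: "\<forall>w \<in> lfd A b xl xu j \<alpha>. s * w \<le> s * v" "\<alpha>' = set_coord \<alpha> j v"
    and s: "s = 1 \<or> s = -1"
    using lift unfolding lift_move_iff_extreme by (auto simp: s_def sgn_if)
  have int: "\<alpha> $ j \<in> \<int>" "v \<in> \<int>"
    using \<alpha> \<alpha>'(1) v(2) by (auto simp: int_points_def set_coord_nth dest: spec[of _ j])
  have "s * (v + s) > s * v"
    using s by auto
  then have "v + s \<notin> lfd A b xl xu j \<alpha>"
    using v(1) by force
  then have "set_coord \<alpha> j (v + s) \<notin> feasible_region A b"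
    using lfd_if_feasible[OF bounds] int s by auto
  then show ?thesis
    using boundary_if_unit_step_infeasible[OF \<alpha>' s, of j] by (simp add: v(2) set_coord_nth)
qed

section \<open>Unit incremental moves\<close>

lemma int_greatest:
  fixes P :: "int \<Rightarrow> bool"
  assumes "P k\<^sub>0" "\<And>k. P k \<Longrightarrow> k \<le> B"
  obtains m where "P m" "\<And>k. P k \<Longrightarrow> k \<le> m"
proof -
  have fin: "finite {k. P k \<and> k\<^sub>0 \<le> k}"
    by (rule finite_subset[of _ "{k\<^sub>0..B}"]) (auto simp: assms)
  define m where "m = Max {k. P k \<and> k\<^sub>0 \<le> k}"
  have "m \<in> {k. P k \<and> k\<^sub>0 \<le> k}"
    unfolding m_def using fin assms(1) by (intro Max_in) auto
  moreover have "k \<le> m" if "P k" "k\<^sub>0 \<le> k" for k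
    unfolding m_def using fin that by (intro Max_ge) auto
  ultimately show ?thesis
    using that[of m] by force
qed

text \<open>Along the improving direction the objective decreases by \<open>\<bar>c\<^sub>j\<bar>\<close> per step, so the optimal value
  limits the number of feasible steps. The last feasible one is the target of a lift move, and it lies
  at least as far out as the feasible unit step.\<close>

lemma positive_lift_move_if_unit_step_feasible:
  assumes bounds: "valid_bounds xl xu" "bounds_are_rows A b xl xu"
    and opt: "optimal_solution A b c x"
    and \<alpha>: "\<alpha> \<in> int_points" "\<alpha> \<in> feasible_region A b"
    and c: "c $ j \<noteq> 0"
    and step: "set_coord \<alpha> j (\<alpha> $ j - sgn (c $ j)) \<in> feasible_region A b"
  shows "\<exists>\<beta>. positive_lift_move A b c xl xu j \<alpha> \<beta>"
proof -
  define s where "s = - sgn (c $ j)"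
  have s: "s = 1 \<or> s = -1" and cs: "c $ j * s = - \<bar>c $ j\<bar>"
    using c by (auto simp: s_def sgn_if)
  have ss: "s * s = 1" "s * (s * t) = t" for t
    using s by auto
  have s_int: "s * t \<in> \<int>" if "t \<in> \<int>" for t
    using s that by auto
  have int: "\<alpha> $ j \<in> \<int>"
    using \<alpha>(1) by (simp add: int_points_def)
  \<comment> \<open>With the coordinate written as \<open>s * k\<close>, larger \<open>k\<close> means a better objective for either sign of \<open>c\<^sub>j\<close>.\<close>
  define F where "F k \<longleftrightarrow> set_coord \<alpha> j (s * of_int k) \<in> feasible_region A b" for k :: int
  obtain k\<^sub>1 where k1: "of_int k\<^sub>1 = s * \<alpha> $ j + 1"
    using Ints_add[OF s_int[OF int] Ints_1] by (metis Ints_cases)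
  have "s * of_int k\<^sub>1 = \<alpha> $ j - sgn (c $ j)"
    by (simp add: k1 distrib_left ss) (simp add: s_def)
  then have F1: "F k\<^sub>1"
    using step by (simp add: F_def)
  have bound: "k \<le> \<lfloor>(c \<bullet> \<alpha> - c \<bullet> x) / \<bar>c $ j\<bar> + s * \<alpha> $ j\<rfloor>" if "F k" for k
  proof -
    have "set_coord \<alpha> j (s * of_int k) \<in> int_points"
      using \<alpha>(1) s_int by (auto simp: int_points_def set_coord_nth)
    then have "c \<bullet> x \<le> c \<bullet> set_coord \<alpha> j (s * of_int k)"
      using opt that by (auto simp: optimal_solution_def F_def)
    also have "\<dots> = c \<bullet> \<alpha> + c $ j * s * (of_int k - s * \<alpha> $ j)"
      by (simp add: inner_set_coord right_diff_distrib ss mult.assoc)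
    also have "\<dots> = c \<bullet> \<alpha> - (of_int k - s * \<alpha> $ j) * \<bar>c $ j\<bar>"
      by (simp add: cs)
    finally have "(of_int k - s * \<alpha> $ j) * \<bar>c $ j\<bar> \<le> c \<bullet> \<alpha> - c \<bullet> x"
      by simp
    then have "of_int k - s * \<alpha> $ j \<le> (c \<bullet> \<alpha> - c \<bullet> x) / \<bar>c $ j\<bar>"
      using c by (simp add: pos_le_divide_eq)
    then show ?thesis
      by (simp add: le_floor_iff)
  qed
  obtain m where m: "F m" "\<And>k. F k \<Longrightarrow> k \<le> m"
    using int_greatest[of F, OF F1 bound] by blast
  define v where "v = s * of_int m"
  have v: "v \<in> lfd A b xl xu j \<alpha>"
    using m(1) int s_int unfolding v_def F_def by (intro lfd_if_feasible[OF bounds]) auto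
  \<comment> \<open>A real \<open>w\<close> beyond \<open>v\<close> would round, in direction \<open>s\<close>, to a feasible integer beyond \<open>v\<close>.\<close>
  have extreme: "s * w \<le> s * v" if w: "w \<in> lfd A b xl xu j \<alpha>" for w
  proof -
    have "s * of_int \<lceil>s * w\<rceil> \<in> lfd A b xl xu j \<alpha>"
      using s lfd_round[OF bounds(1) int w] by (auto simp: ceiling_minus)
    then have "F \<lceil>s * w\<rceil>"
      unfolding F_def using int s_int by (intro feasible_if_lfd[OF \<alpha>(2)]) auto
    then have "\<lceil>s * w\<rceil> \<le> m"
      by (rule m(2))
    then show ?thesis
      by (simp add: v_def ss ceiling_le_iff)
  qed
  have "lift_move A b c xl xu j \<alpha> (set_coord \<alpha> j v)"
    using c v extreme unfolding lift_move_iff_extreme s_def by blast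
  moreover have "c \<bullet> \<alpha> - c \<bullet> set_coord \<alpha> j v > 0"
  proof -
    have "s * \<alpha> $ j + 1 \<le> of_int m"
      using m(2)[OF F1] by (simp flip: k1)
    moreover have "c \<bullet> \<alpha> - c \<bullet> set_coord \<alpha> j v = \<bar>c $ j\<bar> * (of_int m - s * \<alpha> $ j)"
    proof -
      have "c \<bullet> \<alpha> - c \<bullet> set_coord \<alpha> j v = - (c $ j * s) * (of_int m - s * \<alpha> $ j)"
        by (simp add: inner_set_coord v_def right_diff_distrib ss mult.assoc)
      then show ?thesis by (simp add: cs)
    qed
    ultimately show ?thesis
      using c by simp
  qed
  ultimately show ?thesis
    unfolding positive_lift_move_def by blast
qed

lemma unit_incremental_move_infeasible:
  assumes "valid_bounds xl xu" "bounds_are_rows A b xl xu"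
    and "optimal_solution A b c x"
    and "\<alpha> \<in> int_points" "\<alpha> \<in> feasible_region A b"
    and "\<not> (\<exists>\<beta>. positive_lift_move A b c xl xu j \<alpha> \<beta>)"
    and "unit_incremental_move c xl xu j \<alpha> \<alpha>'"
  shows "\<alpha>' \<notin> feasible_region A b"
proof -
  have "c $ j \<noteq> 0" "\<alpha>' = set_coord \<alpha> j (\<alpha> $ j - sgn (c $ j))"
    using assms(7) by (auto simp: unit_incremental_move_def sgn_if)
  then show ?thesis
    using positive_lift_move_if_unit_step_feasible[OF assms(1-5)] assms(6) by blast
qed

section \<open>Feasible solutions generated by Local-ILP\<close>

theorem proposition4:
  fixes A :: "real ^ 'n ^ 'm" and b :: "real ^ 'm" and c :: "real ^ 'n"
    and xl xu :: "'n \<Rightarrow> ereal" and \<alpha> \<alpha>' :: "real ^ 'n"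
  assumes "valid_bounds xl xu"
    and "bounds_are_rows A b xl xu"
    and "c \<noteq> 0"
    and "\<not> (\<exists>j. free_variable A c xl xu j)"
    and "\<exists>x. optimal_solution A b c x"
    and "\<alpha> \<in> int_points" and "within_bounds xl xu \<alpha>"
    and "\<alpha>' \<in> int_points" and "\<alpha>' \<in> feasible_region A b"
    and "(\<alpha> \<notin> feasible_region A b \<and>
            (\<exists>j i. A $ i $ j \<noteq> 0 \<and> \<alpha>' = tight_move A b xl xu j i \<alpha>)) \<or>
         (\<alpha> \<in> feasible_region A b \<and> (\<exists>j. lift_move A b c xl xu j \<alpha> \<alpha>')) \<or>
         (\<alpha> \<in> feasible_region A b \<and>
            \<not> (\<exists>j \<beta>. positive_lift_move A b c xl xu j \<alpha> \<beta>) \<and>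
            (\<exists>j. unit_incremental_move c xl xu j \<alpha> \<alpha>')) \<or>
         (\<exists>j. bound_move xl xu j \<alpha> \<alpha>')"
  shows "\<alpha>' \<in> boundary_points (feasible_region A b)"
proof -
  note bounds = assms(1,2) and \<alpha>' = assms(8,9)
  from assms(10) consider
      (tight) j i where "A $ i $ j \<noteq> 0" "\<alpha>' = tight_move A b xl xu j i \<alpha>"
    | (lift) j where "lift_move A b c xl xu j \<alpha> \<alpha>'"
    | (unit) j where "\<alpha> \<in> feasible_region A b"
        "\<not> (\<exists>j \<beta>. positive_lift_move A b c xl xu j \<alpha> \<beta>)" "unit_incremental_move c xl xu j \<alpha> \<alpha>'"
    | (bound) j where "bound_move xl xu j \<alpha> \<alpha>'"
    by blast
  then show ?thesis
  proof cases
    case tight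
    then show ?thesis
      using tight_move_boundary bounds assms(6,7) \<alpha>' by blast
  next
    case lift
    then show ?thesis
      using lift_move_boundary bounds assms(6) \<alpha>' by blast
  next
    case unit
    then show ?thesis
      using unit_incremental_move_infeasible bounds assms(5,6) \<alpha>'(2) by blast
  next
    case bound
    then have "ereal (\<alpha>' $ j) = xl j \<or> ereal (\<alpha>' $ j) = xu j"
      by (auto simp: bound_move_def set_coord_nth)
    then show ?thesis
      using boundary_if_at_bound bounds \<alpha>' by blast
  qed
qed

end
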